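(* For every finite coloring of $\mathbb{N}$ there exists $\lambda\in\mathbb{N}$ such that for every $k\in\mathbb{N}$ there exist a finite set $A\subseteq\mathbb{N}$ which contains a $k$-term arithmetic progression, a $k$-term geometric progression, a $k$-FS and a $k$-FP, and a set $B\subseteq\mathbb{N}$ which is central both in $(\mathbb{N},+)$ and in $(\mathbb{N},\cdot)$, such that the set \[(\lambda+A)\cup(\lambda+B)\cup(\lambda+AB)\cup(A+B)\] is monochromatic.
   Context: $\mathbb{N}=\{1,2,3,\dots\}$. For nonempty $A,B\subseteq\mathbb{N}$ and $x\in\mathbb{N}$: $A+B=\{a+b:a\in A,b\in B\}$, $AB=\{ab:a\in A,b\in B\}$, $x+A=\{x+a:a\in A\}$. A set $A$ contains a $k$-term arithmetic progression if $\{a,a+d,\dots,a+(k-1)d\}\subseteq A$ for some $a,d\in\mathbb{N}$; it contains a $k$-term geometric progression if $\{a,ar,\dots,ar^{k-1}\}\subseteq A$ for some $a,r\in\mathbb{N}$, $r\ge 2$. It contains a $k$-FS (resp. $k$-FP) if there are $a_1,\dots,a_k\in\mathbb{N}$ with $\sum_{i\in F}a_i\in A$ (resp. $\prod_{i\in F}a_i\in A$) for every nonempty $F\subseteq\{1,\dots,k\}$. Central sets: for a semigroup $(S,\ast)$, $\beta S$ is the set of ultrafilters on $S$ (with the usual Stone–Čech topology); the operation extends to $\beta S$ by $A\in p\ast q$ iff $\{s\in S:\{t\in S: s\ast t\in A\}\in q\}\in p$, making $\beta S$ a compact right topological semigroup. A minimal idempotent is an idempotent of $(\beta S,\ast)$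 lying in its smallest two-sided ideal. A set $A\subseteq S$ is central in $(S,\ast)$ if $A\in p$ for some minimal idempotent $p$ of $(\beta S,\ast)$. *)

theory Defs
  imports "HOL-Analysis.Analysis" "HOL-Library.Set_Algebras"
begin

abbreviation posnat :: "nat set"  (\<open>\<nat>\<^sub>+\<close>)
  where "\<nat>\<^sub>+ \<equiv> {1..}"

subsection \<open>The semigroup of ultrafilters\<close>

text \<open>
  A semigroup is given by a carrier \<open>S\<close> and an operation \<open>f\<close>, read as an operation on \<open>S\<close>.
  An ultrafilter on \<open>S\<close> is a library filter \<open>p\<close> on the surrounding type that
  contains \<open>S\<close> (that is, \<open>p \<le> principal S\<close>); a set \<open>A\<close> belongs to \<open>p\<close> iff
  \<open>\<forall>\<^sub>F x in p. x \<in> A\<close>.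
\<close>

definition ultrafilters_on :: "'a set \<Rightarrow> 'a filter set"
  where "ultrafilters_on S =
    {p. p \<noteq> bot \<and> p \<le> principal S \<and> (\<forall>P. eventually P p \<or> eventually (\<lambda>x. \<not> P x) p)}"

definition ultra_op :: "('a \<Rightarrow> 'a \<Rightarrow> 'a) \<Rightarrow> 'a filter \<Rightarrow> 'a filter \<Rightarrow> 'a filter"
  where "ultra_op f p q = Abs_filter (\<lambda>P. \<forall>\<^sub>F s in p. \<forall>\<^sub>F t in q. P (f s t))"

lemma eventually_ultra_op:
  "eventually P (ultra_op f p q) \<longleftrightarrow> (\<forall>\<^sub>F s in p. \<forall>\<^sub>F t in q. P (f s t))"
  unfolding ultra_op_def
proof (rule eventually_Abs_filter, rule is_filter.intro)
  show "\<forall>\<^sub>F s in p. \<forall>\<^sub>F t in q. True"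
    by simp
next
  fix P Q
  assume "\<forall>\<^sub>F s in p. \<forall>\<^sub>F t in q. P (f s t)" "\<forall>\<^sub>F s in p. \<forall>\<^sub>F t in q. Q (f s t)"
  then show "\<forall>\<^sub>F s in p. \<forall>\<^sub>F t in q. P (f s t) \<and> Q (f s t)"
    by eventually_elim (rule eventually_conj)
next
  fix P Q :: "'a \<Rightarrow> bool"
  assume "\<forall>x. P x \<longrightarrow> Q x" "\<forall>\<^sub>F s in p. \<forall>\<^sub>F t in q. P (f s t)"
  then show "\<forall>\<^sub>F s in p. \<forall>\<^sub>F t in q. Q (f s t)"
    by (auto elim!: eventually_mono)
qed

lemma ultra_op_in_ultrafilters_on:
  assumes closed: "\<And>s t. s \<in> S \<Longrightarrow> t \<in> S \<Longrightarrow> f s t \<in> S"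
    and p: "p \<in> ultrafilters_on S" and q: "q \<in> ultrafilters_on S"
  shows "ultra_op f p q \<in> ultrafilters_on S"
proof -
  have pS: "\<forall>\<^sub>F s in p. s \<in> S" and qS: "\<forall>\<^sub>F t in q. t \<in> S"
    and "p \<noteq> bot" "q \<noteq> bot"
    and pU: "\<And>P. eventually P p \<or> eventually (\<lambda>x. \<not> P x) p"
    and qU: "\<And>P. eventually P q \<or> eventually (\<lambda>x. \<not> P x) q"
    using p q by (auto simp: ultrafilters_on_def le_principal)
  have "ultra_op f p q \<noteq> bot"
    using \<open>p \<noteq> bot\<close> \<open>q \<noteq> bot\<close> by (simp add: trivial_limit_def eventually_ultra_op)
  moreover have "\<forall>\<^sub>F s in p. \<forall>\<^sub>F t in q. f s t \<in> S"
    using pS by (rule eventually_mono) (use qS closed in \<open>auto elim!: eventually_mono\<close>)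
  then have "ultra_op f p q \<le> principal S"
    by (simp add: le_principal eventually_ultra_op)
  moreover have "eventually P (ultra_op f p q) \<or> eventually (\<lambda>x. \<not> P x) (ultra_op f p q)" for P
  proof -
    have "\<forall>\<^sub>F t in q. \<not> P (f s t)" if "\<not> (\<forall>\<^sub>F t in q. P (f s t))" for s
      using qU[of "\<lambda>t. P (f s t)"] that by blast
    then show ?thesis
      using pU[of "\<lambda>s. \<forall>\<^sub>F t in q. P (f s t)"]
      unfolding eventually_ultra_op by (metis (mono_tags, lifting) eventually_mono)
  qed
  ultimately show ?thesis
    by (simp add: ultrafilters_on_def)
qed

definition ultra_ideal :: "'a set \<Rightarrow> ('a \<Rightarrow> 'a \<Rightarrow> 'a) \<Rightarrow> 'a filter set \<Rightarrow> bool"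
  where "ultra_ideal S f I \<longleftrightarrow> I \<noteq> {} \<and> I \<subseteq> ultrafilters_on S \<and>
    (\<forall>p\<in>ultrafilters_on S. \<forall>q\<in>I. ultra_op f p q \<in> I \<and> ultra_op f q p \<in> I)"

text \<open>
  A compact right topological semigroup has a smallest two-sided ideal, so it is the
  intersection of all of them.
\<close>

definition smallest_ultra_ideal :: "'a set \<Rightarrow> ('a \<Rightarrow> 'a \<Rightarrow> 'a) \<Rightarrow> 'a filter set"
  where "smallest_ultra_ideal S f = \<Inter>{I. ultra_ideal S f I}"

definition minimal_idempotent :: "'a set \<Rightarrow> ('a \<Rightarrow> 'a \<Rightarrow> 'a) \<Rightarrow> 'a filter \<Rightarrow> bool"
  where "minimal_idempotent S f p \<longleftrightarrow>
    p \<in> ultrafilters_on S \<and> ultra_op f p p = p \<and> p \<in> smallest_ultra_ideal S f"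

definition central :: "'a set \<Rightarrow> ('a \<Rightarrow> 'a \<Rightarrow> 'a) \<Rightarrow> 'a set \<Rightarrow> bool"
  where "central S f A \<longleftrightarrow> A \<subseteq> S \<and> (\<exists>p. minimal_idempotent S f p \<and> (\<forall>\<^sub>F x in p. x \<in> A))"

subsection \<open>Finite configurations\<close>

definition contains_AP :: "nat \<Rightarrow> nat set \<Rightarrow> bool"
  where "contains_AP k A \<longleftrightarrow> (\<exists>a\<in>\<nat>\<^sub>+. \<exists>d\<in>\<nat>\<^sub>+. \<forall>i<k. a + i * d \<in> A)"

definition contains_GP :: "nat \<Rightarrow> nat set \<Rightarrow> bool"
  where "contains_GP k A \<longleftrightarrow> (\<exists>a\<in>\<nat>\<^sub>+. \<exists>r\<ge>2. \<forall>i<k. a * r ^ i \<in> A)"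

text \<open>As in the source, the generators \<open>a i\<close> need not be distinct or exceed \<open>1\<close>.\<close>

definition contains_FS :: "nat \<Rightarrow> nat set \<Rightarrow> bool"
  where "contains_FS k A \<longleftrightarrow>
    (\<exists>a. (\<forall>i\<in>{1..k}. a i \<in> \<nat>\<^sub>+) \<and> (\<forall>F. F \<subseteq> {1..k} \<and> F \<noteq> {} \<longrightarrow> (\<Sum>i\<in>F. a i) \<in> A))"

definition contains_FP :: "nat \<Rightarrow> nat set \<Rightarrow> bool"
  where "contains_FP k A \<longleftrightarrow>
    (\<exists>a. (\<forall>i\<in>{1..k}. a i \<in> \<nat>\<^sub>+) \<and> (\<forall>F. F \<subseteq> {1..k} \<and> F \<noteq> {} \<longrightarrow> (\<Prod>i\<in>F. a i) \<in> A))"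

end

theory Submission
  imports Defs
begin

text \<open>
  Dilations map minimal idempotents of \<open>(\<beta>\<nat>, +)\<close> to minimal idempotents, so the closure of
  the set of these is a left ideal of \<open>(\<beta>\<nat>, \<cdot>)\<close> and contains a minimal idempotent \<open>p\<close> of
  \<open>(\<beta>\<nat>, \<cdot>)\<close>. Every member of \<open>p\<close> is central for both operations, hence rich in progressions,
  FS and FP configurations. Let \<open>\<phi> a\<close> be the colour of \<open>a + b\<close> for \<open>p\<close>-many \<open>b\<close>, and \<open>d\<close> the
  value of \<open>\<phi> a\<close> for \<open>p\<close>-many \<open>a\<close>. Fix \<open>l\<close> with \<open>\<phi> l = d\<close>. Since \<open>p \<cdot> p = p\<close>, for
  \<open>p\<close>-many \<open>a\<close> the numbers \<open>l + a\<close>, and for \<open>p\<close>-many \<open>b\<close> also \<open>l + a * b\<close> and \<open>a + b\<close>, have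
  colour \<open>d\<close>. Take \<open>A\<close> to be a finite rich set of such \<open>a\<close>; then \<open>p\<close>-many \<open>b\<close> work for all
  \<open>a \<in> A\<close> at once, and they form \<open>B\<close>.
\<close>

section \<open>Ultrafilters as minimal filters\<close>

text \<open>Zorn's lemma for closed sets of ultrafilters: a finer filter stands for a smaller closed
  set, \<open>Inf\<close> for intersection, \<open>bot\<close> for the empty set. The infimum of a
  chain of proper filters is proper because the chain is a filter base. \<open>Q\<close> is meant
  for closure properties, such as being a subsemigroup or a left ideal.\<close>

lemma ex_minimal_filter:
  fixes F :: "'a filter"
  assumes "F \<noteq> bot" and "Q F"
    and Inf: "\<And>C. C \<noteq> {} \<Longrightarrow> (\<And>G. G \<in> C \<Longrightarrow> Q G) \<Longrightarrow> Q (Inf C)"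
  obtains G where "G \<le> F" "G \<noteq> bot" "Q G" "\<And>H. H \<le> G \<Longrightarrow> H \<noteq> bot \<Longrightarrow> Q H \<Longrightarrow> H = G"
proof -
  define \<A> where "\<A> = {G. G \<le> F \<and> G \<noteq> bot \<and> Q G}"
  have "\<exists>G\<in>\<A>. \<forall>H\<in>\<A>. H \<le> G \<longrightarrow> H = G"
  proof (rule predicate_Zorn[of \<A> "\<lambda>x y. y \<le> x", simplified])
    show "partial_order_on \<A> (relation_of (\<lambda>x y. y \<le> x) \<A>)"
      by (rule partial_order_on_relation_ofI) auto
  next
    fix C assume "C \<in> Chains (relation_of (\<lambda>x y. y \<le> x) \<A>)"
    then have C: "C \<subseteq> \<A>" "\<And>G H. G \<in> C \<Longrightarrow> H \<in> C \<Longrightarrow> G \<le> H \<or> H \<le> G"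
      by (auto simp: Chains_def relation_of_def)
    show "\<exists>u\<in>\<A>. \<forall>G\<in>C. u \<le> G"
    proof (cases "C = {}")
      case True
      then show ?thesis using assms by (auto simp: \<A>_def)
    next
      case False
      have "eventually (\<lambda>_. False) (Inf C) \<longleftrightarrow> (\<exists>G\<in>C. eventually (\<lambda>_. False) G)"
        by (rule eventually_Inf_base[OF False]) (metis C(2) inf.order_iff inf.commute order_refl)
      then have "Inf C \<noteq> bot"
        using C(1) by (auto simp: trivial_limit_def \<A>_def)
      moreover have "Inf C \<le> F"
        using False C(1) by (auto simp: \<A>_def intro: Inf_lower2)
      moreover have "Q (Inf C)"
        using False C(1) by (intro Inf) (auto simp: \<A>_def)
      ultimately show ?thesis
        by (auto simp: \<A>_def intro!: bexI[of _ "Inf C"] Inf_lower)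
    qed
  qed
  then obtain G where "G \<in> \<A>" "\<And>H. H \<in> \<A> \<Longrightarrow> H \<le> G \<Longrightarrow> H = G"
    by blast
  then show ?thesis
    using that[of G] by (auto simp: \<A>_def intro: order_trans)
qed

lemma ultrafilters_onD:
  assumes "p \<in> ultrafilters_on S"
  shows "p \<noteq> bot" "p \<le> principal S" "\<forall>\<^sub>F x in p. x \<in> S"
    and "\<And>P. \<not> eventually P p \<Longrightarrow> \<forall>\<^sub>F x in p. \<not> P x"
  using assms unfolding ultrafilters_on_def le_principal by blast+

lemma ultrafilter_eqI:
  assumes "p \<in> ultrafilters_on S" "q \<le> p" "q \<noteq> bot"
  shows "q = p"
proof (rule antisym[OF \<open>q \<le> p\<close>], rule filter_leI)
  fix P assume "eventually P q"
  show "eventually P p"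
  proof (rule ccontr)
    assume "\<not> eventually P p"
    then have "\<forall>\<^sub>F x in p. \<not> P x"
      by (rule ultrafilters_onD(4)[OF assms(1)])
    then have "\<forall>\<^sub>F x in q. \<not> P x"
      using \<open>q \<le> p\<close> by (rule filter_leD[rotated])
    with \<open>eventually P q\<close> have "\<forall>\<^sub>F x in q. False"
      by eventually_elim simp
    with \<open>q \<noteq> bot\<close> show False
      by (simp add: trivial_limit_def)
  qed
qed

lemma inf_principal_eq_bot_iff: "inf F (principal X) = bot \<longleftrightarrow> (\<forall>\<^sub>F x in F. x \<notin> X)"
  by (simp add: trivial_limit_def eventually_inf_principal)

text \<open>A minimal proper filter is an ultrafilter: meeting it with a set yields
  \<open>bot\<close> or the filter itself.\<close>

lemma ex_ultrafilter_le:
  assumes "F \<noteq> bot" "F \<le> principal S"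
  obtains p where "p \<in> ultrafilters_on S" "p \<le> F"
proof -
  obtain p where p: "p \<le> F" "p \<noteq> bot" and min: "\<And>H. H \<le> p \<Longrightarrow> H \<noteq> bot \<Longrightarrow> H = p"
    by (rule ex_minimal_filter[of F "\<lambda>_. True"]) (simp_all add: assms(1))
  have "eventually P p \<or> (\<forall>\<^sub>F x in p. \<not> P x)" for P
  proof (cases "inf p (principal {x. P x}) = bot")
    case True
    then show ?thesis by (simp add: inf_principal_eq_bot_iff)
  next
    case False
    then have "inf p (principal {x. P x}) = p"
      by (intro min) auto
    then have "p \<le> principal {x. P x}"
      by (metis inf_le2)
    then show ?thesis by (simp add: le_principal)
  qed
  then show ?thesis
    using that[OF _ p(1)] p(2) order_trans[OF p(1) assms(2)] unfolding ultrafilters_on_def by blast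
qed

text \<open>A set in \<open>G\<close> but not in \<open>F\<close> would be avoided by some
  ultrafilter finer than \<open>F\<close>. Inclusions between closed sets can thus be checked
  pointwise.\<close>

lemma filter_le_if_ultrafilters_le:
  assumes "F \<le> principal S" and "\<And>u. u \<in> ultrafilters_on S \<Longrightarrow> u \<le> F \<Longrightarrow> u \<le> G"
  shows "F \<le> G"
proof (rule filter_leI, rule ccontr)
  fix P assume P: "eventually P G" "\<not> eventually P F"
  then have "inf F (principal {x. \<not> P x}) \<noteq> bot"
    by (simp add: inf_principal_eq_bot_iff)
  then obtain u where u: "u \<in> ultrafilters_on S" "u \<le> inf F (principal {x. \<not> P x})"
    by (rule ex_ultrafilter_le) (use assms(1) in \<open>auto intro: le_infI1\<close>)
  then have "\<forall>\<^sub>F x in u. P x" "\<forall>\<^sub>F x in u. \<not> P x"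
    using assms(2)[of u] P(1) by (auto simp: le_principal dest: filter_leD)
  then have "\<forall>\<^sub>F x in u. False"
    by eventually_elim simp
  with ultrafilters_onD(1)[OF u(1)] show False
    by (simp add: trivial_limit_def)
qed

lemma ultrafilter_eventually_bex:
  assumes p: "p \<in> ultrafilters_on S" and "finite I" "\<forall>\<^sub>F x in p. \<exists>i\<in>I. P i x"
  shows "\<exists>i\<in>I. \<forall>\<^sub>F x in p. P i x"
proof (rule ccontr)
  assume "\<not> ?thesis"
  then have "\<forall>i\<in>I. \<forall>\<^sub>F x in p. \<not> P i x"
    using ultrafilters_onD(4)[OF p] by blast
  then have "\<forall>\<^sub>F x in p. \<forall>i\<in>I. \<not> P i x"
    using \<open>finite I\<close> by (simp add: eventually_ball_finite)
  with assms(3) have "\<forall>\<^sub>F x in p. False"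
    by eventually_elim simp
  with ultrafilters_onD(1)[OF p] show False
    by (simp add: trivial_limit_def)
qed

text \<open>For a set \<open>M\<close> of ultrafilters, being finer than \<open>Sup M\<close> means
  lying in the closure of \<open>M\<close>. A set negligible for every member of \<open>M\<close> is
  negligible for \<open>p\<close>.\<close>

lemma ultrafilter_le_Sup:
  assumes "p \<in> ultrafilters_on S" "p \<le> Sup M" "eventually P p"
  shows "\<exists>m\<in>M. \<exists>\<^sub>F x in m. P x"
proof (rule ccontr)
  assume "\<not> ?thesis"
  then have "\<forall>\<^sub>F x in Sup M. \<not> P x"
    by (simp add: eventually_Sup frequently_def)
  then have "\<forall>\<^sub>F x in p. \<not> P x"
    using assms(2) by (rule filter_leD[rotated])
  with assms(3) have "\<forall>\<^sub>F x in p. False"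
    by eventually_elim simp
  with ultrafilters_onD(1)[OF assms(1)] show False
    by (simp add: trivial_limit_def)
qed

lemma filtermap_in_ultrafilters_on:
  assumes "p \<in> ultrafilters_on S" "\<forall>\<^sub>F x in p. h x \<in> T"
  shows "filtermap h p \<in> ultrafilters_on T"
proof -
  have "eventually P (filtermap h p) \<or> (\<forall>\<^sub>F x in filtermap h p. \<not> P x)" for P
    using ultrafilters_onD(4)[OF assms(1), of "\<lambda>x. P (h x)"] by (auto simp: eventually_filtermap)
  then show ?thesis
    using ultrafilters_onD(1)[OF assms(1)] assms(2)
    by (simp add: ultrafilters_on_def le_principal eventually_filtermap filtermap_bot_iff)
qed

lemma principal_in_ultrafilters_on: "x \<in> S \<Longrightarrow> principal {x} \<in> ultrafilters_on S"
  by (auto simp: ultrafilters_on_def eventually_principal principal_eq_bot_iff)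

section \<open>Idempotents in compact right topological semigroups of ultrafilters\<close>

lemma ultra_op_mono: "p \<le> p' \<Longrightarrow> ultra_op f p q \<le> ultra_op f p' q"
  by (auto simp: le_filter_def eventually_ultra_op)

lemma ultra_op_neq_bot: "p \<noteq> bot \<Longrightarrow> q \<noteq> bot \<Longrightarrow> ultra_op f p q \<noteq> bot"
  by (simp add: trivial_limit_def eventually_ultra_op)

lemma filtermap_ultra_op:
  assumes "\<And>x y. h (f x y) = g (h x) (h y)"
  shows "filtermap h (ultra_op f p q) = ultra_op g (filtermap h p) (filtermap h q)"
  by (simp add: filter_eq_iff eventually_filtermap eventually_ultra_op assms)

lemma ultra_op_principal: "ultra_op f (principal {x}) q = filtermap (f x) q"
  by (simp add: filter_eq_iff eventually_filtermap eventually_ultra_op eventually_principal)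

locale ultra_semigroup = semigroup f
  for f :: "'a \<Rightarrow> 'a \<Rightarrow> 'a" (infixl \<open>\<cdot>\<close> 70) +
  fixes S :: "'a set"
  assumes closed: "\<And>x y. x \<in> S \<Longrightarrow> y \<in> S \<Longrightarrow> x \<cdot> y \<in> S"
begin

abbreviation \<beta>S where "\<beta>S \<equiv> ultrafilters_on S"

abbreviation op_beta  (infixl \<open>\<odot>\<close> 70) where "p \<odot> q \<equiv> ultra_op f p q"

lemma op_assoc: "p \<odot> q \<odot> r = p \<odot> (q \<odot> r)"
  by (simp add: filter_eq_iff eventually_ultra_op assoc)

lemma op_closed: "p \<in> \<beta>S \<Longrightarrow> q \<in> \<beta>S \<Longrightarrow> p \<odot> q \<in> \<beta>S"
  by (rule ultra_op_in_ultrafilters_on[OF closed])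

lemma op_le_principal:
  assumes "p \<le> principal S" "q \<le> principal S"
  shows "p \<odot> q \<le> principal S"
proof -
  have p: "\<forall>\<^sub>F s in p. s \<in> S" and q: "\<forall>\<^sub>F t in q. t \<in> S"
    using assms by (simp_all add: le_principal)
  have "\<forall>\<^sub>F s in p. \<forall>\<^sub>F t in q. s \<cdot> t \<in> S"
    using p by (rule eventually_mono) (rule eventually_mono[OF q], rule closed)
  then show ?thesis
    by (simp add: le_principal eventually_ultra_op)
qed

text \<open>By compactness, the image of a closed set under right translation is closed.\<close>

lemma ultrafilter_le_op:
  assumes q: "q \<in> \<beta>S" and F: "F \<le> principal S" and u: "u \<in> \<beta>S" "u \<le> F \<odot> q"
  obtains r where "r \<in> \<beta>S" "r \<le> F" "u = r \<odot> q"
proof -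
  \<comment> \<open>\<open>r \<odot> q = u\<close> holds as soon as \<open>r\<close> contains every
    \<open>X P\<close> with \<open>P\<close> in \<open>u\<close>, so \<open>G\<close> adjoins all
    these sets to \<open>F\<close>. They are directed, so properness of \<open>G\<close> can be
    tested on one \<open>P\<close> at a time; failure would put the negation of \<open>P\<close>
    into \<open>u\<close>, since \<open>q\<close> decides every set.\<close>
  define X where "X P = {s. \<forall>\<^sub>F t in q. P (s \<cdot> t)}" for P
  define G where "G = (INF P\<in>{P. eventually P u}. inf F (principal (X P)))"
  have nonbot: "inf F (principal (X P)) \<noteq> bot" if "eventually P u" for P
  proof
    assume "inf F (principal (X P)) = bot"
    then have "\<forall>\<^sub>F s in F. \<not> (\<forall>\<^sub>F t in q. P (s \<cdot> t))"
      by (simp add: inf_principal_eq_bot_iff X_def)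
    then have "\<forall>\<^sub>F s in F. \<forall>\<^sub>F t in q. \<not> P (s \<cdot> t)"
      by eventually_elim (rule ultrafilters_onD(4)[OF q])
    then have "\<forall>\<^sub>F x in u. \<not> P x"
      using u(2) by (simp add: le_filter_def eventually_ultra_op)
    with that have "\<forall>\<^sub>F x in u. False"
      by eventually_elim simp
    with ultrafilters_onD(1)[OF u(1)] show False
      by (simp add: trivial_limit_def)
  qed
  have "eventually (\<lambda>_. False) G \<longleftrightarrow>
      (\<exists>P\<in>{P. eventually P u}. eventually (\<lambda>_. False) (inf F (principal (X P))))"
    unfolding G_def
  proof (rule eventually_INF_base)
    show "{P. eventually P u} \<noteq> {}"
      by (auto intro!: exI[of _ "\<lambda>_. True"])
  next
    fix P Q assume PQ: "P \<in> {P. eventually P u}" "Q \<in> {P. eventually P u}"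
    have "X (\<lambda>x. P x \<and> Q x) \<subseteq> X P \<inter> X Q"
      by (auto simp: X_def elim: eventually_mono)
    then have "inf F (principal (X (\<lambda>x. P x \<and> Q x))) \<le> inf (inf F (principal (X P))) (inf F (principal (X Q)))"
      by (intro le_infI) (auto intro: le_infI1 le_infI2)
    with PQ show "\<exists>R\<in>{P. eventually P u}. inf F (principal (X R))
        \<le> inf (inf F (principal (X P))) (inf F (principal (X Q)))"
      by (auto intro!: exI[of _ "\<lambda>x. P x \<and> Q x"] simp: eventually_conj_iff)
  qed
  with nonbot have "G \<noteq> bot"
    by (auto simp: trivial_limit_def)
  moreover have GP: "G \<le> inf F (principal (X P))" if "eventually P u" for P
    unfolding G_def by (rule INF_lower) (use that in simp)
  then have "G \<le> F"
    using GP[of "\<lambda>_. True"] by simp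
  ultimately obtain r where r: "r \<in> \<beta>S" "r \<le> G"
    using ex_ultrafilter_le[of G S] F by (auto intro: order_trans)
  have "r \<odot> q \<le> u"
  proof (rule filter_leI)
    fix P assume "eventually P u"
    then have "r \<le> principal (X P)"
      using GP r(2) by (meson order_trans le_infE)
    then show "eventually P (r \<odot> q)"
      by (simp add: eventually_ultra_op le_principal X_def)
  qed
  then have "u = r \<odot> q"
    using ultrafilter_eqI[OF u(1)] ultrafilters_onD(1)[OF op_closed[OF r(1) q]] by blast
  with r(1) order_trans[OF r(2) \<open>G \<le> F\<close>] show ?thesis
    by (rule that)
qed

text \<open>The Ellis--Numakura lemma. Here and below, a closed set of ultrafilters is given as
  the set of all ultrafilters finer than some filter.\<close>

lemma ex_idempotent_le:
  assumes "F \<noteq> bot" "F \<le> principal S"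
    and sub: "\<And>p q. p \<in> \<beta>S \<Longrightarrow> q \<in> \<beta>S \<Longrightarrow> p \<le> F \<Longrightarrow> q \<le> F \<Longrightarrow> p \<odot> q \<le> F"
  obtains p where "p \<in> \<beta>S" "p \<le> F" "p \<odot> p = p"
proof -
  let ?Q = "\<lambda>F. \<forall>p\<in>\<beta>S. \<forall>q\<in>\<beta>S. p \<le> F \<longrightarrow> q \<le> F \<longrightarrow> p \<odot> q \<le> F"
  obtain G where G: "G \<le> F" "G \<noteq> bot" and subG: "?Q G"
    and min: "\<And>H. H \<le> G \<Longrightarrow> H \<noteq> bot \<Longrightarrow> ?Q H \<Longrightarrow> H = G"
  proof (rule ex_minimal_filter[of F ?Q])
    fix C assume "C \<noteq> {}" "\<And>G. G \<in> C \<Longrightarrow> ?Q G"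
    then show "?Q (Inf C)"
      by (auto simp: le_Inf_iff)
  qed (use assms in auto)
  have GS: "G \<le> principal S"
    using G(1) assms(2) by (rule order_trans)
  obtain p where p: "p \<in> \<beta>S" "p \<le> G"
    using ex_ultrafilter_le[OF G(2) GS] .
  note pD = ultrafilters_onD[OF p(1)]
  \<comment> \<open>\<open>G \<odot> p\<close> is a closed subsemigroup inside \<open>G\<close>.
    Equality exhibits \<open>p\<close> as \<open>r \<odot> p\<close> for some \<open>r\<close> in
    \<open>G\<close>.\<close>
  have "G \<odot> p = G"
  proof (rule min)
    show "G \<odot> p \<le> G"
    proof (rule filter_le_if_ultrafilters_le)
      show "G \<odot> p \<le> principal S"
        using GS pD(2) by (rule op_le_principal)
    next
      fix u assume "u \<in> \<beta>S" "u \<le> G \<odot> p"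
      then show "u \<le> G"
        using ultrafilter_le_op[OF p(1) GS] subG p by metis
    qed
    show "G \<odot> p \<noteq> bot"
      using G(2) pD(1) by (rule ultra_op_neq_bot)
    show "?Q (G \<odot> p)"
    proof (intro ballI impI)
      fix u v assume uv: "u \<in> \<beta>S" "v \<in> \<beta>S" "u \<le> G \<odot> p" "v \<le> G \<odot> p"
      obtain r where r: "r \<in> \<beta>S" "r \<le> G" "u = r \<odot> p"
        using ultrafilter_le_op[OF p(1) GS uv(1,3)] .
      obtain s where s: "s \<in> \<beta>S" "s \<le> G" "v = s \<odot> p"
        using ultrafilter_le_op[OF p(1) GS uv(2,4)] .
      have "r \<odot> p \<odot> s \<le> G"
        using r s p subG op_closed by blast
      then have "r \<odot> p \<odot> s \<odot> p \<le> G \<odot> p"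
        by (rule ultra_op_mono)
      then show "u \<odot> v \<le> G \<odot> p"
        by (simp add: r s op_assoc)
    qed
  qed
  then obtain r where r: "r \<in> \<beta>S" "r \<le> G" "r \<odot> p = p"
    using ultrafilter_le_op[OF p(1) GS p(1)] p(2) by metis
  \<comment> \<open>The stabiliser of \<open>p\<close> in \<open>G\<close> is a nonempty
    subsemigroup, and \<open>fixed\<close> shows that taking its closure adds nothing harmful. A
    second use of minimality makes it all of \<open>G\<close>, so \<open>p\<close> stabilises
    itself.\<close>
  define M where "M = {r \<in> \<beta>S. r \<le> G \<and> r \<odot> p = p}"
  have fixed: "r \<odot> p = p" if "r \<in> \<beta>S" "r \<le> Sup M" for r
  proof (rule ultrafilter_eqI[OF p(1)])
    show "r \<odot> p \<le> p"
    proof (rule filter_leI)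
      fix P assume "eventually P p"
      then have "eventually P (m \<odot> p)" if "m \<in> M" for m
        using that by (simp add: M_def)
      then have "\<forall>\<^sub>F s in Sup M. \<forall>\<^sub>F t in p. P (s \<cdot> t)"
        by (simp add: eventually_Sup eventually_ultra_op)
      then show "eventually P (r \<odot> p)"
        using \<open>r \<le> Sup M\<close> by (simp add: eventually_ultra_op le_filter_def)
    qed
    show "r \<odot> p \<noteq> bot"
      using ultrafilters_onD(1)[OF that(1)] ultrafilters_onD(1)[OF p(1)] by (rule ultra_op_neq_bot)
  qed
  have "Sup M \<le> G"
    by (auto simp: M_def intro: Sup_least)
  have "Sup M = G"
  proof (rule min)
    have "r \<le> Sup M"
      using r by (auto simp: M_def intro: Sup_upper)
    then show "Sup M \<noteq> bot"
      using ultrafilters_onD(1)[OF r(1)] by (metis bot_unique)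
    show "?Q (Sup M)"
    proof (intro ballI impI)
      fix u v assume uv: "u \<in> \<beta>S" "v \<in> \<beta>S" "u \<le> Sup M" "v \<le> Sup M"
      then have "u \<odot> v \<odot> p = p"
        by (simp add: op_assoc fixed)
      moreover have "u \<odot> v \<le> G"
        using uv subG \<open>Sup M \<le> G\<close> by (blast intro: order_trans)
      ultimately have "u \<odot> v \<in> M"
        using uv op_closed by (simp add: M_def)
      then show "u \<odot> v \<le> Sup M"
        by (rule Sup_upper)
    qed
  qed fact
  then have "p \<odot> p = p"
    using fixed p by simp
  with p(1) order_trans[OF p(2) G(1)] show ?thesis
    by (rule that)
qed

section \<open>Minimal left ideals and minimal idempotents\<close>

text \<open>For \<open>p \<in> \<beta>S\<close> this says that \<open>\<beta>S \<odot> p\<close> is a minimal left ideal containing \<open>p\<close>.\<close>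

definition left_minimal :: "'a filter \<Rightarrow> bool"
  where "left_minimal p \<longleftrightarrow> (\<forall>r\<in>\<beta>S. \<exists>t\<in>\<beta>S. t \<odot> (r \<odot> p) = p)"

text \<open>Zorn's lemma gives a minimal closed left ideal \<open>G\<close>, and Ellis--Numakura an
  idempotent \<open>p\<close> in it. For every \<open>r\<close> the closed left ideal
  \<open>\<beta>S \<odot> (r \<odot> p)\<close> lies in \<open>G\<close>, hence equals
  \<open>G\<close> and contains \<open>p\<close>.\<close>

lemma ex_left_minimal_idempotent_le:
  assumes "F \<noteq> bot" "F \<le> principal S"
    and ideal: "\<And>p q. p \<in> \<beta>S \<Longrightarrow> q \<in> \<beta>S \<Longrightarrow> q \<le> F \<Longrightarrow> p \<odot> q \<le> F"
  obtains p where "p \<in> \<beta>S" "p \<le> F" "p \<odot> p = p" "left_minimal p"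
proof -
  let ?Q = "\<lambda>F. \<forall>p\<in>\<beta>S. \<forall>q\<in>\<beta>S. q \<le> F \<longrightarrow> p \<odot> q \<le> F"
  obtain G where G: "G \<le> F" "G \<noteq> bot" and idG: "?Q G"
    and min: "\<And>H. H \<le> G \<Longrightarrow> H \<noteq> bot \<Longrightarrow> ?Q H \<Longrightarrow> H = G"
  proof (rule ex_minimal_filter[of F ?Q])
    fix C assume "C \<noteq> {}" "\<And>G. G \<in> C \<Longrightarrow> ?Q G"
    then show "?Q (Inf C)"
      by (auto simp: le_Inf_iff)
  qed (use assms in auto)
  have GS: "G \<le> principal S"
    using G(1) assms(2) by (rule order_trans)
  obtain p where p: "p \<in> \<beta>S" "p \<le> G" "p \<odot> p = p"
    using ex_idempotent_le[OF G(2) GS] idG by blast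
  have "\<exists>t\<in>\<beta>S. t \<odot> (r \<odot> p) = p" if r: "r \<in> \<beta>S" for r
  proof -
    define q where "q = r \<odot> p"
    have q: "q \<in> \<beta>S" "q \<le> G"
      using r p idG op_closed by (auto simp: q_def)
    note cover = ultrafilter_le_op[OF q(1) order_refl]
    \<comment> \<open>The ultrafilters below \<open>principal S \<odot> q\<close> are exactly the
      products \<open>t \<odot> q\<close>, so this filter encodes the left ideal
      \<open>\<beta>S \<odot> q\<close>.\<close>
    have "principal S \<odot> q = G"
    proof (rule min)
      show "principal S \<odot> q \<le> G"
      proof (rule filter_le_if_ultrafilters_le)
        show "principal S \<odot> q \<le> principal S"
          using order_refl ultrafilters_onD(2)[OF q(1)] by (rule op_le_principal)
      next
        fix u assume "u \<in> \<beta>S" "u \<le> principal S \<odot> q"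
        then show "u \<le> G"
          using cover idG q by metis
      qed
      show "principal S \<odot> q \<noteq> bot"
        using ultrafilters_onD(1,2)[OF q(1)]
        by (intro ultra_op_neq_bot) (auto simp: bot_unique)
      show "?Q (principal S \<odot> q)"
      proof (intro ballI impI)
        fix v u assume vu: "v \<in> \<beta>S" "u \<in> \<beta>S" "u \<le> principal S \<odot> q"
        obtain t where t: "t \<in> \<beta>S" "u = t \<odot> q"
          using cover[OF vu(2,3)] by metis
        have "v \<odot> t \<odot> q \<le> principal S \<odot> q"
          using op_closed[OF vu(1) t(1)] by (intro ultra_op_mono ultrafilters_onD(2))
        then show "v \<odot> u \<le> principal S \<odot> q"
          by (simp add: t op_assoc)
      qed
    qed
    then show ?thesis
      using cover[OF p(1)] p(2) unfolding q_def by metis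
  qed
  then have "left_minimal p"
    by (simp add: left_minimal_def)
  with p(1) order_trans[OF p(2) G(1)] p(3) show ?thesis
    by (rule that)
qed

text \<open>For \<open>r\<close> in a two-sided ideal, \<open>t \<odot> (r \<odot> p) = p\<close>
  puts \<open>p\<close> into that ideal as well.\<close>

lemma left_minimal_imp_minimal_idempotent:
  assumes "p \<in> \<beta>S" "p \<odot> p = p" "left_minimal p"
  shows "minimal_idempotent S f p"
proof -
  have "p \<in> I" if I: "ultra_ideal S f I" for I
  proof -
    obtain r where "r \<in> I" "r \<in> \<beta>S"
      using I by (auto simp: ultra_ideal_def)
    then obtain t where "t \<in> \<beta>S" "t \<odot> (r \<odot> p) = p"
      using assms(3) by (auto simp: left_minimal_def)
    then show ?thesis
      using I assms(1) \<open>r \<in> I\<close> unfolding ultra_ideal_def by metis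
  qed
  with assms show ?thesis
    by (auto simp: minimal_idempotent_def smallest_ultra_ideal_def)
qed

text \<open>Minimality in the usual order of idempotents: from \<open>t \<odot> r = p\<close>
  follows \<open>p \<odot> r = t \<odot> r \<odot> r = t \<odot> r = p\<close>, whereas
  \<open>p \<odot> r = r\<close>.\<close>

lemma left_minimal_eqI:
  assumes "left_minimal p" "r \<in> \<beta>S" "r \<odot> r = r" "p \<odot> r = r" "r \<odot> p = r"
  shows "r = p"
proof -
  obtain t where "t \<odot> r = p"
    using assms by (auto simp: left_minimal_def)
  then show ?thesis
    using assms(3,4) op_assoc by metis
qed

end

section \<open>Configurations in the members of idempotents\<close>

text \<open>The Hales--Jewett argument: \<open>V\<close> plays the role of the variable words, \<open>\<sigma> i\<close> that of the
  substitution of the letter \<open>i\<close>. An idempotent of \<open>V\<close> below the copy \<open>e(p)\<close> of \<open>p\<close> is sent by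
  each \<open>\<sigma> i\<close> to an idempotent below \<open>p\<close>, that is, to \<open>p\<close> itself.\<close>

lemma left_minimal_idempotent_hales_jewett:
  fixes \<sigma> :: "'i \<Rightarrow> 'b \<Rightarrow> 'a"
  assumes S: "ultra_semigroup f S" and T: "ultra_semigroup g T"
    and V: "V \<subseteq> T" "V \<noteq> {}"
    and ideal: "\<And>x v. x \<in> T \<Longrightarrow> v \<in> V \<Longrightarrow> g x v \<in> V" "\<And>x v. x \<in> T \<Longrightarrow> v \<in> V \<Longrightarrow> g v x \<in> V"
    and e: "\<And>x y. e (f x y) = g (e x) (e y)" "\<And>x. x \<in> S \<Longrightarrow> e x \<in> T"
    and \<sigma>: "\<And>i x y. \<sigma> i (g x y) = f (\<sigma> i x) (\<sigma> i y)" "\<And>i x. x \<in> T \<Longrightarrow> \<sigma> i x \<in> S"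
    and \<sigma>e: "\<And>i x. \<sigma> i (e x) = x"
    and p: "p \<in> ultrafilters_on S" "ultra_op f p p = p" "ultra_semigroup.left_minimal f S p"
    and A: "\<forall>\<^sub>F x in p. x \<in> A" and "finite I"
  shows "\<exists>v\<in>V. \<forall>i\<in>I. \<sigma> i v \<in> A"
proof -
  interpret S: ultra_semigroup f S by fact
  interpret T: ultra_semigroup g T by fact
  define p' where "p' = filtermap e p"
  have p': "p' \<in> T.\<beta>S" "ultra_op g p' p' = p'"
  proof -
    show "p' \<in> T.\<beta>S"
      unfolding p'_def
      by (rule filtermap_in_ultrafilters_on[OF p(1)])
        (use ultrafilters_onD(3)[OF p(1)] e(2) in \<open>auto elim: eventually_mono\<close>)
    show "ultra_op g p' p' = p'"
      unfolding p'_def by (simp add: p(2) flip: filtermap_ultra_op[where h = e and f = f and g = g, OF e(1)])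
  qed
  have op_V: "ultra_op g a b \<le> principal V"
    if "a \<le> principal V \<and> b \<le> principal T \<or> a \<le> principal T \<and> b \<le> principal V" for a b
  proof -
    from that have "\<forall>\<^sub>F s in a. \<forall>\<^sub>F t in b. g s t \<in> V"
    proof
      assume "a \<le> principal V \<and> b \<le> principal T"
      then have *: "\<forall>\<^sub>F s in a. s \<in> V" "\<forall>\<^sub>F t in b. t \<in> T"
        by (simp_all add: le_principal)
      show "\<forall>\<^sub>F s in a. \<forall>\<^sub>F t in b. g s t \<in> V"
        using *(1) by (rule eventually_mono) (rule eventually_mono[OF *(2)], rule ideal(2))
    next
      assume "a \<le> principal T \<and> b \<le> principal V"
      then have *: "\<forall>\<^sub>F s in a. s \<in> T" "\<forall>\<^sub>F t in b. t \<in> V"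
        by (simp_all add: le_principal)
      show "\<forall>\<^sub>F s in a. \<forall>\<^sub>F t in b. g s t \<in> V"
        using *(1) by (rule eventually_mono) (rule eventually_mono[OF *(2)], rule ideal(1))
    qed
    then show ?thesis
      by (simp add: le_principal eventually_ultra_op)
  qed
  \<comment> \<open>\<open>?F\<close> encodes the products \<open>ultra_op g r p'\<close> with
    \<open>r\<close> concentrated on \<open>V\<close>. They form a semigroup since \<open>V\<close>
    is an ideal, and \<open>p'\<close> is a right identity for them since it is idempotent.\<close>
  let ?F = "ultra_op g (principal V) p'"
  have VT: "principal V \<le> principal T"
    using V by simp
  have F: "?F \<noteq> bot" "?F \<le> principal V"
    using V ultrafilters_onD(1,2)[OF p'(1)] ultra_op_neq_bot[of "principal V" p' g]
    by (auto intro!: op_V simp: principal_eq_bot_iff)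
  obtain u where u: "u \<in> T.\<beta>S" "u \<le> ?F" "ultra_op g u u = u"
  proof (rule T.ex_idempotent_le[of ?F])
    show "?F \<le> principal T"
      using F(2) VT by (rule order_trans)
  next
    fix a b assume ab: "a \<in> T.\<beta>S" "b \<in> T.\<beta>S" "a \<le> ?F" "b \<le> ?F"
    obtain r where r: "r \<in> T.\<beta>S" "r \<le> principal V" "b = ultra_op g r p'"
      using T.ultrafilter_le_op[OF p'(1) VT ab(2,4)] .
    have "ultra_op g a r \<le> principal V"
      using ab(1) r(2) by (intro op_V) (simp add: ultrafilters_onD)
    then have "ultra_op g (ultra_op g a r) p' \<le> ?F"
      by (rule ultra_op_mono)
    then show "ultra_op g a b \<le> ?F"
      by (simp add: r T.op_assoc)
  qed (use F in auto)
  obtain w where w: "u = ultra_op g w p'"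
    using T.ultrafilter_le_op[OF p'(1) VT u(1,2)] by metis
  have up': "ultra_op g u p' = u"
    by (simp add: w T.op_assoc p')
  \<comment> \<open>Multiplying \<open>u\<close> by \<open>p'\<close> on the left makes
    \<open>p'\<close> a two-sided identity for \<open>q\<close>, so \<open>q\<close> lies below
    \<open>p'\<close> in the order of idempotents. The homomorphisms \<open>\<sigma> i\<close>
    preserve this relation.\<close>
  define q where "q = ultra_op g p' u"
  have q: "q \<in> T.\<beta>S" "q \<le> principal V"
    using T.op_closed[OF p'(1) u(1)] op_V[of p' u] ultrafilters_onD(2)[OF p'(1)]
      order_trans[OF u(2) F(2)] unfolding q_def by blast+
  have p'q: "ultra_op g p' q = q"
    unfolding q_def by (simp add: p' flip: T.op_assoc)
  have qp': "ultra_op g q p' = q"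
    unfolding q_def by (simp add: up' T.op_assoc)
  have qq: "ultra_op g q q = q"
    using qp' u(3) unfolding q_def by (metis T.op_assoc)
  have \<sigma>p': "filtermap (\<sigma> i) p' = p" for i
    by (simp add: p'_def filtermap_filtermap \<sigma>e)
  have \<sigma>q: "filtermap (\<sigma> i) q = p" for i
  proof (rule S.left_minimal_eqI[OF p(3)])
    have hom: "filtermap (\<sigma> i) (ultra_op g a b) = ultra_op f (filtermap (\<sigma> i) a) (filtermap (\<sigma> i) b)" for a b
      by (rule filtermap_ultra_op) (rule \<sigma>)
    show "filtermap (\<sigma> i) q \<in> S.\<beta>S"
      by (rule filtermap_in_ultrafilters_on[OF q(1)])
        (use ultrafilters_onD(3)[OF q(1)] \<sigma>(2) in \<open>auto elim: eventually_mono\<close>)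
    show "ultra_op f (filtermap (\<sigma> i) q) (filtermap (\<sigma> i) q) = filtermap (\<sigma> i) q"
      using hom[of q q] qq by simp
    show "ultra_op f p (filtermap (\<sigma> i) q) = filtermap (\<sigma> i) q"
      using hom[of p' q] p'q \<sigma>p' by simp
    show "ultra_op f (filtermap (\<sigma> i) q) p = filtermap (\<sigma> i) q"
      using hom[of q p'] qp' \<sigma>p' by simp
  qed
  have "\<forall>\<^sub>F v in q. \<sigma> i v \<in> A" for i
    using A unfolding \<sigma>q[of i, symmetric] eventually_filtermap .
  then have "\<forall>\<^sub>F v in q. \<forall>i\<in>I. \<sigma> i v \<in> A"
    using \<open>finite I\<close> by (simp add: eventually_ball_finite)
  moreover have "\<forall>\<^sub>F v in q. v \<in> V"
    using q(2) by (simp add: le_principal)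
  ultimately have "\<forall>\<^sub>F v in q. v \<in> V \<and> (\<forall>i\<in>I. \<sigma> i v \<in> A)"
    by (rule eventually_conj[rotated])
  then show ?thesis
    using eventually_happens'[OF ultrafilters_onD(1)[OF q(1)]] by blast
qed

text \<open>Galvin's argument, placed in \<open>comm_monoid_set\<close> to cover sums and products
  at once. By idempotence some \<open>s\<close> in \<open>A\<close> has \<open>f s t\<close> in
  \<open>A\<close> for \<open>p\<close>-many \<open>t\<close>; recursion inside the set of such
  \<open>t\<close> in \<open>A\<close> yields the other generators, and \<open>s\<close> becomes the
  last one.\<close>

lemma (in comm_monoid_set) idempotent_finite_products:
  assumes p: "p \<in> ultrafilters_on S" "ultra_op f p p = p" and A: "\<forall>\<^sub>F x in p. x \<in> A"
  shows "\<exists>a. (\<forall>i\<in>{1..k::nat}. a i \<in> S) \<and> (\<forall>J. J \<subseteq> {1..k} \<and> J \<noteq> {} \<longrightarrow> F a J \<in> A)"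
  using A
proof (induction k arbitrary: A)
  case 0
  then show ?case by auto
next
  case (Suc k)
  have "\<forall>\<^sub>F s in p. \<forall>\<^sub>F t in p. f s t \<in> A"
    using Suc.prems by (subst (asm) p(2)[symmetric]) (simp add: eventually_ultra_op)
  then have "\<forall>\<^sub>F s in p. s \<in> A \<and> s \<in> S \<and> (\<forall>\<^sub>F t in p. f s t \<in> A)"
    by (intro eventually_conj Suc.prems ultrafilters_onD(3)[OF p(1)])
  then obtain s where s: "s \<in> A" "s \<in> S" "\<forall>\<^sub>F t in p. f s t \<in> A"
    using eventually_happens'[OF ultrafilters_onD(1)[OF p(1)], of "\<lambda>s. s \<in> A \<and> s \<in> S \<and> (\<forall>\<^sub>F t in p. f s t \<in> A)"]
    by blast
  have "\<forall>\<^sub>F t in p. t \<in> {t \<in> A. f s t \<in> A}"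
    using eventually_conj[OF Suc.prems s(3)] by simp
  from Suc.IH[OF this] obtain a where aS: "\<forall>i\<in>{1..k}. a i \<in> S"
    and aA: "\<forall>J. J \<subseteq> {1..k} \<and> J \<noteq> {} \<longrightarrow> F a J \<in> {t \<in> A. f s t \<in> A}"
    by (elim exE conjE)
  have a: "\<And>i. i \<in> {1..k} \<Longrightarrow> a i \<in> S"
    "\<And>J. J \<subseteq> {1..k} \<Longrightarrow> J \<noteq> {} \<Longrightarrow> F a J \<in> A \<and> f s (F a J) \<in> A"
    using aS aA by simp_all
  define b where "b = a(Suc k := s)"
  have Fb: "F b J = F a J" if "J \<subseteq> {1..k}" for J
    using that by (intro cong) (auto simp: b_def)
  have "F b J \<in> A" if J: "J \<subseteq> {1..Suc k}" "J \<noteq> {}" for J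
  proof (cases "Suc k \<in> J")
    case False
    then have "J \<subseteq> {1..k}"
      using J(1) by (auto simp: le_Suc_eq)
    then show ?thesis
      using a(2) Fb J(2) by simp
  next
    case True
    define J' where "J' = J - {Suc k}"
    have J': "J = insert (Suc k) J'" "Suc k \<notin> J'" "J' \<subseteq> {1..k}" "finite J'"
      using J True finite_subset[of J "{1..Suc k}"] by (auto simp: J'_def le_Suc_eq)
    have "F b J = f s (F a J')"
      using J' Fb[of J'] by (simp add: b_def)
    then show ?thesis
      using a(2)[of J'] s(1) J' by (cases "J' = {}") auto
  qed
  moreover have "b i \<in> S" if "i \<in> {1..Suc k}" for i
    using that a(1)[of i] s(2) by (auto simp: b_def le_Suc_eq)
  ultimately show ?case
    by blast
qed

section \<open>The natural numbers\<close>

interpretation add: ultra_semigroup "plus :: nat \<Rightarrow> nat \<Rightarrow> nat" "\<nat>\<^sub>+"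
  by unfold_locales auto

interpretation mult: ultra_semigroup "times :: nat \<Rightarrow> nat \<Rightarrow> nat" "\<nat>\<^sub>+"
  by unfold_locales auto

text \<open>A pair \<open>(a, d)\<close> is a word in which the letter \<open>i\<close> is
  substituted as \<open>a + i * d\<close>. \<open>T\<close> admits difference 0 to accommodate the
  constant words \<open>(a, 0)\<close>; the ideal \<open>V\<close> demands a positive
  difference.\<close>

lemma add_left_minimal_contains_AP:
  assumes p: "p \<in> ultrafilters_on \<nat>\<^sub>+" "ultra_op plus p p = p" "add.left_minimal p"
    and A: "\<forall>\<^sub>F x in p. x \<in> A"
  shows "contains_AP k A"
proof -
  have "\<exists>v\<in>\<nat>\<^sub>+ \<times> \<nat>\<^sub>+. \<forall>i\<in>{..<k}. (\<lambda>i (a, d). a + i * d) i v \<in> A"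
  proof (rule left_minimal_idempotent_hales_jewett[OF add.ultra_semigroup_axioms _ _ _ _ _ _ _ _ _ _ p A,
        where g = "\<lambda>(a, d) (b, e). (a + b, d + e)" and T = "\<nat>\<^sub>+ \<times> UNIV" and e = "\<lambda>a. (a, 0)"])
    show "ultra_semigroup (\<lambda>(a, d) (b, e). (a + b, d + e)) (\<nat>\<^sub>+ \<times> (UNIV :: nat set))"
      by unfold_locales auto
  qed (auto simp: algebra_simps)
  then show ?thesis
    by (auto simp: contains_AP_def)
qed

text \<open>Here ratio 1 marks the constant words, and the pairs of ratio at least 2 form the
  ideal.\<close>

lemma mult_left_minimal_contains_GP:
  assumes p: "p \<in> ultrafilters_on \<nat>\<^sub>+" "ultra_op times p p = p" "mult.left_minimal p"
    and A: "\<forall>\<^sub>F x in p. x \<in> A"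
  shows "contains_GP k A"
proof -
  have "\<exists>v\<in>\<nat>\<^sub>+ \<times> {2..}. \<forall>i\<in>{..<k}. (\<lambda>i (a, r). a * r ^ i) i v \<in> A"
  proof (rule left_minimal_idempotent_hales_jewett[OF mult.ultra_semigroup_axioms _ _ _ _ _ _ _ _ _ _ p A,
        where g = "\<lambda>(a, d) (b, e). (a * b, d * e)" and T = "\<nat>\<^sub>+ \<times> \<nat>\<^sub>+" and e = "\<lambda>a. (a, 1)"])
    show "ultra_semigroup (\<lambda>(a, d) (b, e). (a * b, d * e)) (\<nat>\<^sub>+ \<times> \<nat>\<^sub>+)"
      by unfold_locales auto
    show "(\<lambda>(a, d) (b, e). (a * b, d * e)) x v \<in> \<nat>\<^sub>+ \<times> {2..}"
      "(\<lambda>(a, d) (b, e). (a * b, d * e)) v x \<in> \<nat>\<^sub>+ \<times> {2..}"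
      if "x \<in> \<nat>\<^sub>+ \<times> \<nat>\<^sub>+" "v \<in> \<nat>\<^sub>+ \<times> {2..}" for x v :: "nat \<times> nat"
      using that mult_le_mono[of 1 "snd x" 2 "snd v"] by (auto simp: mult.commute)
  qed (auto simp: algebra_simps power_mult_distrib)
  then show ?thesis
    by (auto simp: contains_GP_def)
qed

section \<open>Dilations and the closure of the additive minimal idempotents\<close>

text \<open>A suitable translate of \<open>r\<close> concentrates on the multiples of \<open>n\<close>, so it is a dilate
  \<open>n r'\<close>, and left minimality of \<open>q\<close> can be applied to \<open>r'\<close>.\<close>

lemma add_left_minimal_dilate:
  assumes n: "n \<in> \<nat>\<^sub>+" and q: "q \<in> ultrafilters_on \<nat>\<^sub>+" "add.left_minimal q"
  shows "add.left_minimal (filtermap (times n) q)"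
  unfolding add.left_minimal_def
proof
  fix r :: "nat filter" assume r: "r \<in> ultrafilters_on \<nat>\<^sub>+"
  have hom: "filtermap (times n) (ultra_op plus a b) =
      ultra_op plus (filtermap (times n) a) (filtermap (times n) b)" for a b
    by (rule filtermap_ultra_op) (rule distrib_left)
  \<comment> \<open>The residues are represented in \<open>{1..n}\<close> instead of
    \<open>{0..<n}\<close>, so that \<open>principal {s}\<close> is an ultrafilter on the positive
    integers and the quotient \<open>(s + x) div n\<close> is positive.\<close>
  have "\<exists>s\<in>{1..n}. n dvd s + x" for x
  proof
    have "x mod n < n"
      using n by simp
    moreover have "n * (x div n) + x mod n = x"
      by simp
    ultimately have "n - x mod n + x = n * (1 + x div n)"
      by (simp only: distrib_left mult_1_right)
    then show "n dvd n - x mod n + x"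
      by simp
    show "n - x mod n \<in> {1..n}"
      using \<open>x mod n < n\<close> by auto
  qed
  then have "\<exists>s\<in>{1..n}. \<forall>\<^sub>F x in r. n dvd s + x"
    by (intro ultrafilter_eventually_bex[OF r]) auto
  then obtain s where s: "s \<in> {1..n}" and dvd: "\<forall>\<^sub>F x in r. n dvd s + x"
    by blast
  define r' where "r' = filtermap (\<lambda>x. (s + x) div n) r"
  have "\<forall>\<^sub>F x in r. (s + x) div n \<in> \<nat>\<^sub>+"
    using dvd by eventually_elim (use s in \<open>auto simp: div_greater_zero_iff Suc_le_eq dest: dvd_imp_le\<close>)
  then have r': "r' \<in> ultrafilters_on \<nat>\<^sub>+"
    unfolding r'_def by (rule filtermap_in_ultrafilters_on[OF r])
  have "filtermap (\<lambda>x. n * ((s + x) div n)) r = filtermap (plus s) r"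
  proof -
    have "\<forall>\<^sub>F x in r. n * ((s + x) div n) = s + x"
      using dvd by eventually_elim simp
    then show ?thesis
      by (auto simp: filter_eq_iff eventually_filtermap elim: eventually_elim2)
  qed
  then have nr': "filtermap (times n) r' = ultra_op plus (principal {s}) r"
    by (simp add: r'_def filtermap_filtermap ultra_op_principal)
  obtain t where t: "t \<in> ultrafilters_on \<nat>\<^sub>+" "ultra_op plus t (ultra_op plus r' q) = q"
    using q(2) r' unfolding add.left_minimal_def by blast
  \<comment> \<open>The shift by \<open>s\<close> is absorbed into the left factor: written
    additively, n t + s + r + n q = n t + n r' + n q = n (t + r' + q) = n q.\<close>
  define t' where "t' = ultra_op plus (filtermap (times n) t) (principal {s})"
  have "filtermap (times n) t \<in> ultrafilters_on \<nat>\<^sub>+"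
    by (rule filtermap_in_ultrafilters_on[OF t(1)])
      (use ultrafilters_onD(3)[OF t(1)] n in \<open>auto elim: eventually_mono\<close>)
  then have "t' \<in> ultrafilters_on \<nat>\<^sub>+"
    unfolding t'_def using s by (intro add.op_closed principal_in_ultrafilters_on) auto
  moreover have "ultra_op plus t' (ultra_op plus r (filtermap (times n) q)) = filtermap (times n) q"
  proof -
    have "ultra_op plus t' (ultra_op plus r (filtermap (times n) q)) =
        ultra_op plus (filtermap (times n) t) (ultra_op plus (filtermap (times n) r') (filtermap (times n) q))"
      by (simp add: t'_def nr' add.op_assoc)
    also have "\<dots> = filtermap (times n) q"
      by (simp add: t(2) flip: hom)
    finally show ?thesis .
  qed
  ultimately show "\<exists>t\<in>ultrafilters_on \<nat>\<^sub>+.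
      ultra_op plus t (ultra_op plus r (filtermap (times n) q)) = filtermap (times n) q"
    by blast
qed

text \<open>The last clause expresses that \<open>p\<close> lies in the closure of the additive left
  minimal idempotents; this is how one multiplicative idempotent gives access to additive
  structure.\<close>

lemma ex_idempotent_near_additive:
  "\<exists>p\<in>ultrafilters_on \<nat>\<^sub>+. ultra_op times p p = p \<and> mult.left_minimal p \<and>
    (\<forall>A. (\<forall>\<^sub>F x in p. x \<in> A) \<longrightarrow> (\<exists>q\<in>ultrafilters_on \<nat>\<^sub>+.
      ultra_op plus q q = q \<and> add.left_minimal q \<and> (\<forall>\<^sub>F x in q. x \<in> A)))"
proof -
  define M where "M = {q \<in> ultrafilters_on \<nat>\<^sub>+. ultra_op plus q q = q \<and> add.left_minimal q}"
  have dilate: "filtermap (times n) m \<in> M" if "n \<in> \<nat>\<^sub>+" "m \<in> M" for n m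
  proof -
    have "filtermap (times n) m \<in> ultrafilters_on \<nat>\<^sub>+"
      using that ultrafilters_onD(3)[of m "\<nat>\<^sub>+"]
      by (intro filtermap_in_ultrafilters_on[of m "\<nat>\<^sub>+"]) (auto simp: M_def elim: eventually_mono)
    moreover have "ultra_op plus (filtermap (times n) m) (filtermap (times n) m) = filtermap (times n) m"
      using that filtermap_ultra_op[of "times n" plus plus m m] by (simp add: M_def distrib_left)
    ultimately show ?thesis
      using that add_left_minimal_dilate by (simp add: M_def)
  qed
  obtain m where m: "m \<in> M"
  proof (rule add.ex_left_minimal_idempotent_le[of "principal \<nat>\<^sub>+"])
    show "ultra_op plus p q \<le> principal \<nat>\<^sub>+"
      if "p \<in> ultrafilters_on \<nat>\<^sub>+" "q \<in> ultrafilters_on \<nat>\<^sub>+" for p q :: "nat filter"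
      using add.op_closed[OF that] by (rule ultrafilters_onD)
  qed (auto simp: M_def principal_eq_bot_iff)
  obtain p where p: "p \<in> ultrafilters_on \<nat>\<^sub>+" "p \<le> Sup M" "ultra_op times p p = p" "mult.left_minimal p"
  proof (rule mult.ex_left_minimal_idempotent_le[of "Sup M"])
    show "Sup M \<noteq> bot"
      using m Sup_upper[OF m] ultrafilters_onD(1)[of m "\<nat>\<^sub>+"] by (metis (lifting) M_def bot_unique mem_Collect_eq)
    show "Sup M \<le> principal \<nat>\<^sub>+"
      unfolding M_def by (blast intro: Sup_least ultrafilters_onD(2))
    fix p q :: "nat filter"
    assume pq: "p \<in> ultrafilters_on \<nat>\<^sub>+" "q \<in> ultrafilters_on \<nat>\<^sub>+" "q \<le> Sup M"
    \<comment> \<open>As \<open>M\<close> is stable under dilation, so is its closure; hence each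
      dilate of \<open>q\<close> lies there, and so does the limit of these dilates along
      \<open>p\<close>.\<close>
    show "ultra_op times p q \<le> Sup M"
    proof (rule filter_leI)
      fix P :: "nat \<Rightarrow> bool" assume P: "eventually P (Sup M)"
      have "\<forall>\<^sub>F t in q. P (n * t)" if "n \<in> \<nat>\<^sub>+" for n
      proof -
        have "eventually P (filtermap (times n) m)" if "m \<in> M" for m
          using P dilate[OF \<open>n \<in> \<nat>\<^sub>+\<close> that] by (simp add: eventually_Sup)
        then have "\<forall>\<^sub>F t in Sup M. P (n * t)"
          by (simp add: eventually_Sup eventually_filtermap)
        then show ?thesis
          using pq(3) by (rule filter_leD[rotated])
      qed
      then show "eventually P (ultra_op times p q)"
        using ultrafilters_onD(3)[OF pq(1)] by (auto simp: eventually_ultra_op elim: eventually_mono)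
    qed
  qed
  moreover have "\<exists>q\<in>ultrafilters_on \<nat>\<^sub>+.
      ultra_op plus q q = q \<and> add.left_minimal q \<and> (\<forall>\<^sub>F x in q. x \<in> A)"
    if A: "\<forall>\<^sub>F x in p. x \<in> A" for A
  proof -
    obtain q where q: "q \<in> M" "\<exists>\<^sub>F x in q. x \<in> A"
      using ultrafilter_le_Sup[OF p(1,2) A] by blast
    \<comment> \<open>Members of \<open>M\<close> are ultrafilters, so a frequent property is an
      eventual one.\<close>
    then have "\<forall>\<^sub>F x in q. x \<in> A"
      using ultrafilters_onD(4)[of q "\<nat>\<^sub>+" "\<lambda>x. x \<in> A"] by (auto simp: M_def frequently_def)
    with q(1) show ?thesis
      by (auto simp: M_def)
  qed
  ultimately show ?thesis
    by blast
qed

section \<open>Finite subsets carrying a configuration\<close>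

lemma contains_AP_finite_subset:
  assumes "contains_AP k A" shows "\<exists>B\<subseteq>A. finite B \<and> contains_AP k B"
proof -
  obtain a d where "a \<in> \<nat>\<^sub>+" "d \<in> \<nat>\<^sub>+" "\<forall>i<k. a + i * d \<in> A"
    using assms by (auto simp: contains_AP_def)
  then show ?thesis
    by (intro exI[of _ "(\<lambda>i. a + i * d) ` {..<k}"]) (auto simp: contains_AP_def)
qed

lemma contains_GP_finite_subset:
  assumes "contains_GP k A" shows "\<exists>B\<subseteq>A. finite B \<and> contains_GP k B"
proof -
  obtain a r where "a \<in> \<nat>\<^sub>+" "r \<ge> 2" "\<forall>i<k. a * r ^ i \<in> A"
    using assms by (auto simp: contains_GP_def)
  then show ?thesis
    by (intro exI[of _ "(\<lambda>i. a * r ^ i) ` {..<k}"]) (auto simp: contains_GP_def)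
qed

lemma contains_FS_finite_subset:
  assumes "contains_FS k A" shows "\<exists>B\<subseteq>A. finite B \<and> contains_FS k B"
proof -
  obtain a where "\<forall>i\<in>{1..k}. a i \<in> \<nat>\<^sub>+" "\<forall>F. F \<subseteq> {1..k} \<and> F \<noteq> {} \<longrightarrow> sum a F \<in> A"
    using assms unfolding contains_FS_def by blast
  then show ?thesis
    unfolding contains_FS_def by (intro exI[of _ "sum a ` (Pow {1..k} - {{}})"]) blast
qed

lemma contains_FP_finite_subset:
  assumes "contains_FP k A" shows "\<exists>B\<subseteq>A. finite B \<and> contains_FP k B"
proof -
  obtain a where "\<forall>i\<in>{1..k}. a i \<in> \<nat>\<^sub>+" "\<forall>F. F \<subseteq> {1..k} \<and> F \<noteq> {} \<longrightarrow> prod a F \<in> A"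
    using assms unfolding contains_FP_def by blast
  then show ?thesis
    unfolding contains_FP_def by (intro exI[of _ "prod a ` (Pow {1..k} - {{}})"]) blast
qed

lemma contains_mono:
  assumes "A \<subseteq> B"
  shows "contains_AP k A \<Longrightarrow> contains_AP k B" "contains_GP k A \<Longrightarrow> contains_GP k B"
    "contains_FS k A \<Longrightarrow> contains_FS k B" "contains_FP k A \<Longrightarrow> contains_FP k B"
proof -
  show "contains_AP k A \<Longrightarrow> contains_AP k B"
    using assms unfolding contains_AP_def by blast
  show "contains_GP k A \<Longrightarrow> contains_GP k B"
    using assms unfolding contains_GP_def by blast
  show "contains_FS k A \<Longrightarrow> contains_FS k B"
    unfolding contains_FS_def by (erule ex_forward) (use assms in blast)
  show "contains_FP k A \<Longrightarrow> contains_FP k B"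
    unfolding contains_FP_def by (erule ex_forward) (use assms in blast)
qed

section \<open>Construction of the monochromatic set\<close>

theorem theorem1p7:
  fixes c :: "nat \<Rightarrow> 'c"
  assumes "finite (c ` \<nat>\<^sub>+)"
  shows "\<exists>l\<in>\<nat>\<^sub>+. \<forall>k\<in>\<nat>\<^sub>+. \<exists>A B.
    A \<subseteq> \<nat>\<^sub>+ \<and> finite A \<and>
    contains_AP k A \<and> contains_GP k A \<and> contains_FS k A \<and> contains_FP k A \<and>
    B \<subseteq> \<nat>\<^sub>+ \<and> central \<nat>\<^sub>+ plus B \<and> central \<nat>\<^sub>+ times B \<and>
    c constant_on ((l +o A) \<union> (l +o B) \<union> (l +o (A * B)) \<union> (A + B))"
proof -
  obtain p where p: "p \<in> ultrafilters_on \<nat>\<^sub>+" "ultra_op times p p = p" "mult.left_minimal p"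
    and near: "\<And>A. \<forall>\<^sub>F x in p. x \<in> A \<Longrightarrow> \<exists>q\<in>ultrafilters_on \<nat>\<^sub>+.
      ultra_op plus q q = q \<and> add.left_minimal q \<and> (\<forall>\<^sub>F x in q. x \<in> A)"
    using ex_idempotent_near_additive by blast
  note pD = ultrafilters_onD[OF p(1)]
  have "\<exists>d\<in>c ` \<nat>\<^sub>+. \<forall>\<^sub>F b in p. c (a + b) = d" for a
    by (intro ultrafilter_eventually_bex[OF p(1)] assms) (use pD(3) in \<open>auto elim!: eventually_mono\<close>)
  then obtain \<phi> where \<phi>: "\<And>a. \<phi> a \<in> c ` \<nat>\<^sub>+" "\<And>a. \<forall>\<^sub>F b in p. c (a + b) = \<phi> a"
    by metis
  obtain d where d: "\<forall>\<^sub>F a in p. \<phi> a = d"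
    using ultrafilter_eventually_bex[OF p(1) assms, of "\<lambda>d a. \<phi> a = d"] \<phi>(1) by auto
  obtain l where l: "l \<in> \<nat>\<^sub>+" "\<phi> l = d"
    using eventually_happens'[OF pD(1) eventually_conj[OF pD(3) d]] by blast
  have ld: "\<forall>\<^sub>F x in p. c (l + x) = d"
    using \<phi>(2)[of l] l by simp
  then have ldd: "\<forall>\<^sub>F a in p. \<forall>\<^sub>F b in p. c (l + a * b) = d"
    by (subst (asm) p(2)[symmetric]) (simp add: eventually_ultra_op)
  \<comment> \<open>\<open>D\<close>, like \<open>l\<close>, is fixed before \<open>k\<close>
    enters, which is why one shift serves all \<open>k\<close>.\<close>
  define D where "D = {a \<in> \<nat>\<^sub>+. \<phi> a = d \<and> c (l + a) = d \<and> (\<forall>\<^sub>F b in p. c (l + a * b) = d)}"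
  have D: "\<forall>\<^sub>F a in p. a \<in> D"
    unfolding D_def using eventually_conj[OF pD(3) eventually_conj[OF d eventually_conj[OF ld ldd]]] by simp
  have "\<exists>A B. A \<subseteq> \<nat>\<^sub>+ \<and> finite A \<and>
    contains_AP k A \<and> contains_GP k A \<and> contains_FS k A \<and> contains_FP k A \<and>
    B \<subseteq> \<nat>\<^sub>+ \<and> central \<nat>\<^sub>+ plus B \<and> central \<nat>\<^sub>+ times B \<and>
    c constant_on ((l +o A) \<union> (l +o B) \<union> (l +o (A * B)) \<union> (A + B))" for k
  proof -
    \<comment> \<open>Two idempotents contain \<open>D\<close>: the additive \<open>q\<close>
      supplies the arithmetic progression and the finite sums, the multiplicative \<open>p\<close>
      the geometric progression and the finite products.\<close>
    obtain q where q: "q \<in> ultrafilters_on \<nat>\<^sub>+" "ultra_op plus q q = q" "add.left_minimal q"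
      "\<forall>\<^sub>F x in q. x \<in> D"
      using near[OF D] by blast
    have "contains_AP k D" "contains_GP k D"
      using add_left_minimal_contains_AP[OF q] mult_left_minimal_contains_GP[OF p D] .
    moreover have "contains_FS k D" "contains_FP k D"
      unfolding contains_FS_def contains_FP_def
      using sum.idempotent_finite_products[OF q(1,2,4)] prod.idempotent_finite_products[OF p(1,2) D]
      by blast+
    ultimately obtain A1 A2 A3 A4 where
      "A1 \<subseteq> D" "finite A1" "contains_AP k A1" "A2 \<subseteq> D" "finite A2" "contains_GP k A2"
      "A3 \<subseteq> D" "finite A3" "contains_FS k A3" "A4 \<subseteq> D" "finite A4" "contains_FP k A4"
      by (meson contains_AP_finite_subset contains_GP_finite_subset
          contains_FS_finite_subset contains_FP_finite_subset)
    moreover define A where "A = A1 \<union> A2 \<union> A3 \<union> A4"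
    ultimately have A: "A \<subseteq> D" "finite A"
        "contains_AP k A" "contains_GP k A" "contains_FS k A" "contains_FP k A"
      using contains_mono(1)[of A1 A k] contains_mono(2)[of A2 A k]
        contains_mono(3)[of A3 A k] contains_mono(4)[of A4 A k] by auto
    define B where "B = {b \<in> \<nat>\<^sub>+. c (l + b) = d \<and> (\<forall>a\<in>A. c (l + a * b) = d \<and> c (a + b) = d)}"
    have "\<forall>\<^sub>F b in p. \<forall>a\<in>A. c (l + a * b) = d \<and> c (a + b) = d"
    proof (rule eventually_ball_finite[OF A(2)], rule ballI)
      fix a assume "a \<in> A"
      then have "\<forall>\<^sub>F b in p. c (l + a * b) = d" "\<phi> a = d"
        using A(1) by (auto simp: D_def)
      then show "\<forall>\<^sub>F b in p. c (l + a * b) = d \<and> c (a + b) = d"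
        using \<phi>(2)[of a] by (auto intro: eventually_conj)
    qed
    then have B: "\<forall>\<^sub>F b in p. b \<in> B"
      unfolding B_def using eventually_conj[OF pD(3) eventually_conj[OF ld]] by simp
    have "B \<subseteq> \<nat>\<^sub>+"
      by (auto simp: B_def)
    moreover have "central \<nat>\<^sub>+ times B"
      unfolding central_def using mult.left_minimal_imp_minimal_idempotent[OF p] B \<open>B \<subseteq> \<nat>\<^sub>+\<close> by blast
    \<comment> \<open>The additive minimal idempotent witnessing this is obtained afresh from
      \<open>B\<close>; it may differ from \<open>q\<close>.\<close>
    moreover have "central \<nat>\<^sub>+ plus B"
      unfolding central_def
      using near[OF B] add.left_minimal_imp_minimal_idempotent \<open>B \<subseteq> \<nat>\<^sub>+\<close> by blast
    moreover have "c x = d" if "x \<in> (l +o A) \<union> (l +o B) \<union> (l +o (A * B)) \<union> (A + B)" for x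
      using that A(1) by (auto simp: elt_set_plus_def set_plus_def set_times_def B_def D_def)
    then have "c constant_on ((l +o A) \<union> (l +o B) \<union> (l +o (A * B)) \<union> (A + B))"
      unfolding constant_on_def by blast
    moreover have "A \<subseteq> \<nat>\<^sub>+"
      using A(1) by (auto simp: D_def)
    ultimately show ?thesis
      using A by blast
  qed
  with l(1) show ?thesis
    by blast
qed

end
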